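(* Let $1<\alpha,\beta\le 2$, $\mathcal{C}_x,\mathcal{C}_y\ge 0$, $T>0$, and let $\Omega=(L_1,R_1)\times(L_2,R_2)$. Then the compact difference scheme $$(I+S_x)(I+T_y)\,u^{n+1}=(I-S_x)(I-T_y)\,u^{n}+\frac{k_t}{2}\left(s^{n}+s^{n+1}\right),\qquad n=0,1,\dots,N-1,$$ (with $S_x,T_y$ the discrete fractional operators specified in the context) is unconditionally stable.
   Context: The scheme approximates the two-dimensional Riesz space fractional diffusion equation $\partial_t u=\mathcal{C}_x\,\partial^{\alpha}u/\partial|x|^{\alpha}+\mathcal{C}_y\,\partial^{\beta}u/\partial|y|^{\beta}+s(x,y,t)$ on $\Omega\times(0,T]$, with $u(x,y,0)=f(x,y)$ on $\Omega$ and $u=0$ on $\partial\Omega\times(0,T]$. Grid. $M_1,M_2,N$ are positive integers with $M_1,M_2\ge 2$; $h_x=(R_1-L_1)/M_1$, $h_y=(R_2-L_2)/M_2$, $k_t=T/N$; $x_i=L_1+ih_x$, $y_j=L_2+jh_y$, $t_n=nk_t$. The unknown $u^n=(u^n_{i,j})_{1\le i\le M_1-1,\,1\le j\le M_2-1}$ is a real grid function on interior nodes (boundary values are zero), $u^0_{i,j}=f(x_i,y_j)$, and $s^n=(s(x_i,y_j,t_n))_{i,j}$. Discrete operators. Let $A_x=\frac{h_x^2}{12}\,\mathrm{tridiag}(1,10,1)$ and $B_x=\mathrm{tridiag}(1,-2,1)$ be tridiagonal matrices of order $M_1-1$. The matrix $-A_x^{-1}B_x$ represents the operator $-\frac{1}{h_x^2}\frac{\delta_x^2}{1+\delta_x^2/12}$,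 where $\delta_x^2$ is the second-order central difference. It satisfies $-A_x^{-1}B_x=P\mathbf{D}_xP^{-1}$ with $\mathbf{D}_x=\mathrm{diag}(\lambda_1,\dots,\lambda_{M_1-1})$, where $$\lambda_i=\frac{12\sin^2(i\pi/2M_1)}{h_x^2\,(3-\sin^2(i\pi/2M_1))},$$ and where the $i$-th column of $P$ is $(\sin(1\cdot i\pi/M_1),\dots,\sin((M_1-1)i\pi/M_1))^{T}$. Set $\mathcal{D}_{\alpha,x}=P\mathbf{D}_x^{\alpha/2}P^{-1}$ (a matrix of order $M_1-1$) and $S_x=\frac{k_t}{2}\mathcal{C}_x\mathcal{D}_{\alpha,x}$, which acts on a grid function $(v_{i,j})$ in the index $i$ for each fixed $j$. Analogously, with $A_y=\frac{h_y^2}{12}\mathrm{tridiag}(1,10,1)$, $B_y=\mathrm{tridiag}(1,-2,1)$ of order $M_2-1$, write $-A_y^{-1}B_y=Q\mathbf{D}_yQ^{-1}$, where $\mathbf{D}_y=\mathrm{diag}(\gamma_1,\dots,\gamma_{M_2-1})$, $\gamma_j=\frac{12\sin^2(j\pi/2M_2)}{h_y^2(3-\sin^2(j\pi/2M_2))}$, and the $j$-th column of $Q$ is $(\sin(1\cdot j\pi/M_2),\dots,\sin((M_2-1)j\pi/M_2))^T$. Set $\mathcal{D}_{\beta,y}=Q\mathbf{D}_y^{\beta/2}Q^{-1}$ and $T_y=\frac{k_t}{2}\mathcal{C}_y\mathcal{D}_{\beta,y}$, acting in the index $j$ for each fixed $i$. $I$ is the identity. Unconditional stability means: there is a constant $K$,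 independent of $M_1,M_2,N$ and $n$, such that for every choice of $M_1,M_2,N$ (with no restriction relating the step sizes), the scheme is uniquely solvable at each step and any two solutions $u^n,v^n$ of the scheme with the same source $s$ and initial grid functions $u^0,v^0$ satisfy $\|u^n-v^n\|\le K\|u^0-v^0\|$ for $0\le n\le N$, where $\|\cdot\|$ is the Euclidean norm on grid functions. *)

theory Defs
  imports
    "HOL-Analysis.L2_Norm"
    "Jordan_Normal_Form.Gauss_Jordan_Elimination"
begin

text \<open>
  Jordan_Normal_Form matrices are indexed from 0, so row or column index \<open>i\<close> always stands for the
  interior node (respectively the mode) number \<open>i + 1\<close>, with \<open>i < M - 1\<close>.
\<close>

definition sine_mat :: "nat \<Rightarrow> real mat" where
  "sine_mat M = Matrix.mat (M - 1) (M - 1)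
     (\<lambda>(k, i). sin (real (Suc k) * real (Suc i) * pi / real M))"

text \<open>
  The eigenvalues of \<open>- A\<inverse> B\<close> for \<open>A = h\<^sup>2/12 tridiag(1, 10, 1)\<close> and \<open>B = tridiag(1, -2, 1)\<close> of order
  \<open>M - 1\<close>; the columns of \<open>sine_mat M\<close> are the corresponding eigenvectors. They are positive
  for \<open>h \<noteq> 0\<close> and \<open>1 \<le> i \<le> M - 1\<close>, so \<open>powr\<close> below is a genuine power.
\<close>

definition compact_eigenvalue :: "nat \<Rightarrow> real \<Rightarrow> nat \<Rightarrow> real" where
  "compact_eigenvalue M h i =
     12 * (sin (real i * pi / (2 * real M)))\<^sup>2 /
       (h\<^sup>2 * (3 - (sin (real i * pi / (2 * real M)))\<^sup>2))"

text \<open>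
  The matrix \<open>P D\<^bsup>\<alpha>/2\<^esup> P\<inverse>\<close>. The sine matrix is invertible by discrete orthogonality,
  so \<open>mat_inverse\<close>, which returns an option, yields its inverse.
\<close>

definition fractional_mat :: "real \<Rightarrow> nat \<Rightarrow> real \<Rightarrow> real mat" where
  "fractional_mat \<alpha> M h =
     sine_mat M * mat_diag (M - 1) (\<lambda>i. compact_eigenvalue M h (Suc i) powr (\<alpha> / 2))
       * the (mat_inverse (sine_mat M))"

text \<open>
  A grid function \<open>(v\<^bsub>i,j\<^esub>)\<close> on the interior nodes is a matrix of dimension
  \<open>(M\<^sub>1 - 1) \<times> (M\<^sub>2 - 1)\<close>. A matrix acting in the index \<open>i\<close> multiplies it from the left; one acting
  in the index \<open>j\<close> sends \<open>v\<close> to \<open>(\<Sum>\<^sub>l B\<^bsub>j,l\<^esub> v\<^bsub>i,l\<^esub>)\<close>, the product with \<open>B\<^sup>T\<close> from the right.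
\<close>

definition act_x :: "real mat \<Rightarrow> real mat \<Rightarrow> real mat" where
  "act_x A V = A * V"

definition act_y :: "real mat \<Rightarrow> real mat \<Rightarrow> real mat" where
  "act_y B V = V * transpose_mat B"

definition grid_norm :: "real mat \<Rightarrow> real" where
  "grid_norm V = L2_set (\<lambda>ij. V $$ ij) ({..<dim_row V} \<times> {..<dim_col V})"

definition source_grid ::
    "real \<Rightarrow> real \<Rightarrow> real \<Rightarrow> real \<Rightarrow> real \<Rightarrow> nat \<Rightarrow> nat \<Rightarrow> nat \<Rightarrow>
     (real \<Rightarrow> real \<Rightarrow> real \<Rightarrow> real) \<Rightarrow> nat \<Rightarrow> real mat" where
  "source_grid L1 R1 L2 R2 T M1 M2 N s n = Matrix.mat (M1 - 1) (M2 - 1)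
     (\<lambda>(i, j). s (L1 + real (Suc i) * ((R1 - L1) / real M1))
                 (L2 + real (Suc j) * ((R2 - L2) / real M2))
                 (real n * (T / real N)))"

definition scheme_step ::
    "real \<Rightarrow> real \<Rightarrow> real \<Rightarrow> real \<Rightarrow> real \<Rightarrow> real \<Rightarrow> real \<Rightarrow> real \<Rightarrow> real \<Rightarrow>
     nat \<Rightarrow> nat \<Rightarrow> nat \<Rightarrow> (real \<Rightarrow> real \<Rightarrow> real \<Rightarrow> real) \<Rightarrow> nat \<Rightarrow> real mat \<Rightarrow> real mat \<Rightarrow> bool" where
  "scheme_step \<alpha> \<beta> Cx Cy T L1 R1 L2 R2 M1 M2 N s n U V \<longleftrightarrow>
     (let k = T / real N;
          S = (k / 2 * Cx) \<cdot>\<^sub>m fractional_mat \<alpha> M1 ((R1 - L1) / real M1);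
          Ty = (k / 2 * Cy) \<cdot>\<^sub>m fractional_mat \<beta> M2 ((R2 - L2) / real M2);
          src = source_grid L1 R1 L2 R2 T M1 M2 N s
      in act_x (1\<^sub>m (M1 - 1) + S) (act_y (1\<^sub>m (M2 - 1) + Ty) V) =
           act_x (1\<^sub>m (M1 - 1) - S) (act_y (1\<^sub>m (M2 - 1) - Ty) U)
             + (k / 2) \<cdot>\<^sub>m (src n + src (Suc n)))"

text \<open>
  Stability of a family of two-level schemes, where \<open>step M1 M2 N s n U V\<close> says that \<open>V\<close> is an
  admissible value at time level \<open>n + 1\<close> given the value \<open>U\<close> at level \<open>n\<close> and the source data \<open>s\<close>.
  The constant \<open>K\<close> is also uniform in the source and in the initial grid functions.
\<close>

definition grid_solution ::
    "(nat \<Rightarrow> nat \<Rightarrow> nat \<Rightarrow> 's \<Rightarrow> nat \<Rightarrow> real mat \<Rightarrow> real mat \<Rightarrow> bool) \<Rightarrow>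
     nat \<Rightarrow> nat \<Rightarrow> nat \<Rightarrow> 's \<Rightarrow> real mat \<Rightarrow> (nat \<Rightarrow> real mat) \<Rightarrow> bool" where
  "grid_solution step M1 M2 N s u0 u \<longleftrightarrow>
     u 0 = u0 \<and> (\<forall>n\<le>N. u n \<in> carrier_mat (M1 - 1) (M2 - 1)) \<and>
     (\<forall>n<N. step M1 M2 N s n (u n) (u (Suc n)))"

definition unconditionally_stable ::
    "(nat \<Rightarrow> nat \<Rightarrow> nat \<Rightarrow> 's \<Rightarrow> nat \<Rightarrow> real mat \<Rightarrow> real mat \<Rightarrow> bool) \<Rightarrow> bool" where
  "unconditionally_stable step \<longleftrightarrow>
     (\<exists>K::real. \<forall>M1 M2 N. 2 \<le> M1 \<and> 2 \<le> M2 \<and> 1 \<le> N \<longrightarrow>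
        (\<forall>s n U. n < N \<and> U \<in> carrier_mat (M1 - 1) (M2 - 1) \<longrightarrow>
           (\<exists>!V. V \<in> carrier_mat (M1 - 1) (M2 - 1) \<and> step M1 M2 N s n U V)) \<and>
        (\<forall>s u0 v0 u v.
           grid_solution step M1 M2 N s u0 u \<and> grid_solution step M1 M2 N s v0 v \<longrightarrow>
           (\<forall>n\<le>N. grid_norm (u n - v n) \<le> K * grid_norm (u0 - v0))))"

end

theory Submission
  imports Defs
begin

text \<open>
  The two spatial operators are diagonal in the sine basis of their direction, with eigenvalues
  \<open>p\<^sub>i, q\<^sub>j \<ge> 0\<close>: nonnegative multiples of a real power. In the product of the two bases one
  homogeneous step multiplies mode \<open>(i, j)\<close> by
  \<open>(1 - p\<^sub>i) / (1 + p\<^sub>i) * ((1 - q\<^sub>j) / (1 + q\<^sub>j))\<close>, a number of modulus at most 1 whatever the step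
  sizes are. The columns of the sine matrix are orthogonal and share the length \<open>sqrt (M / 2)\<close>,
  so the change of basis is a scaled isometry and a factor bounded by 1 on every mode is a
  contraction of the Euclidean grid norm. Two solutions with the same source differ by a solution
  of the homogeneous scheme, hence \<open>K = 1\<close> works. Since \<open>1 + p\<^sub>i\<close> and \<open>1 + q\<^sub>j\<close> do not vanish, the
  implicit operator is invertible and each step has exactly one solution.

  Discrete orthogonality is \<open>sine_mat_square\<close>. Its consequence \<open>mat_inverse_sine_mat\<close> turns the
  fractional matrices into instances of \<open>sine_multiplier\<close>, matrices that add, multiply and invert
  like the functions on the modes that define them and that are symmetric, so the transposition in
  the \<open>y\<close>-direction disappears. Stability itself rests on
  \<open>grid_norm_sine_multiplier_left_le\<close> and \<open>splitting_step_homogeneous_contraction\<close>.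
\<close>

section \<open>Discrete orthogonality of the sine modes\<close>

text \<open>
  The sum telescopes, because each term is
  \<open>sin ((k + 1/2) * t) - sin ((k - 1/2) * t)\<close>.
\<close>

lemma sum_cos_arith_progression:
  fixes t :: real
  shows "2 * sin (t / 2) * (\<Sum>k<n. cos (real k * t)) = sin ((real n - 1/2) * t) + sin (t / 2)"
proof (induction n)
  case 0
  then show ?case by (simp add: field_simps)
next
  case (Suc n)
  have "2 * sin (t / 2) * cos (real n * t) = sin ((real n + 1/2) * t) - sin ((real n - 1/2) * t)"
    by (simp add: algebra_simps sin_add sin_diff)
  then show ?case
    using Suc.IH by (simp add: algebra_simps)
qed

text \<open>
  The bounds on \<open>m\<close> keep \<open>sin (t / 2)\<close> away from zero for \<open>t = m * pi / M\<close>. The value depends on \<open>m\<close>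
  only through its parity, which is what makes the two sums in the orthogonality relation cancel.
\<close>

lemma sum_cos_grid:
  assumes "0 < m" "m < 2 * M"
  shows "(\<Sum>k<M. cos (real k * (real m * pi / real M))) = (1 - (-1) ^ m) / 2"
proof -
  define t where "t = real m * pi / real M"
  have M: "M > 0" using assms by simp
  have "0 < t / 2" "t / 2 < pi"
    using assms by (auto simp: t_def field_simps simp flip: of_nat_mult)
  then have pos: "sin (t / 2) > 0" by (intro sin_gt_zero) auto
  have Mt: "real M * t = real m * pi" using M by (simp add: t_def)
  have "sin ((real M - 1/2) * t) = sin (real m * pi - t / 2)"
    using Mt by (simp add: algebra_simps)
  also have "\<dots> = - ((-1) ^ m) * sin (t / 2)"
    by (simp add: sin_diff)
  finally have "sin (t / 2) * (2 * (\<Sum>k<M. cos (real k * t))) = sin (t / 2) * (1 - (-1) ^ m)"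
    using sum_cos_arith_progression[of t M] by (simp add: algebra_simps)
  then have "2 * (\<Sum>k<M. cos (real k * t)) = 1 - (-1) ^ m"
    using pos by simp
  then show ?thesis by (simp add: t_def)
qed

text \<open>
  By the product formula the sum is half the difference of the cosine sums at \<open>i - j\<close> and \<open>i + j\<close>.
  These indices have the same parity, so the sums agree unless \<open>i = j\<close>, when the first one is \<open>M\<close>.
  The order of \<open>i\<close> and \<open>j\<close> makes the subtraction one of natural numbers.
\<close>

lemma sum_sin_sin_grid_le:
  assumes ij: "j \<le> i" and j: "0 < j" and i: "i < M"
  shows "(\<Sum>k<M. sin (real k * real i * pi / real M) * sin (real k * real j * pi / real M))
           = (if i = j then real M / 2 else 0)"
proof -
  have prod: "sin (real k * real i * pi / real M) * sin (real k * real j * pi / real M) =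
     (cos (real k * (real (i - j) * pi / real M)) - cos (real k * (real (i + j) * pi / real M))) / 2"
    for k
    using ij by (simp add: sin_times_sin of_nat_diff diff_divide_distrib add_divide_distrib
        algebra_simps)
  have "(\<Sum>k<M. sin (real k * real i * pi / real M) * sin (real k * real j * pi / real M)) =
     ((\<Sum>k<M. cos (real k * (real (i - j) * pi / real M)))
       - (\<Sum>k<M. cos (real k * (real (i + j) * pi / real M)))) / 2"
    by (simp only: prod sum_divide_distrib[symmetric] sum_subtractf)
  also have "\<dots> = (if i = j then real M / 2 else 0)"
  proof (cases "i = j")
    case True
    have "(\<Sum>k<M. cos (real k * (real (i + j) * pi / real M))) = (1 - (-1) ^ (i + j)) / 2"
      using assms by (intro sum_cos_grid) auto
    then show ?thesis using True by simp
  next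
    case False
    have "(\<Sum>k<M. cos (real k * (real (i + j) * pi / real M))) = (1 - (-1) ^ (i + j)) / 2"
      "(\<Sum>k<M. cos (real k * (real (i - j) * pi / real M))) = (1 - (-1) ^ (i - j)) / 2"
      using assms False by (intro sum_cos_grid; simp)+
    moreover have "(-1::real) ^ (i + j) = (-1) ^ (i - j)"
      using ij by (simp add: minus_one_power_iff)
    ultimately show ?thesis using False by simp
  qed
  finally show ?thesis .
qed

lemma sum_sin_sin_grid:
  assumes "0 < j" "j < M" "0 < i" "i < M"
  shows "(\<Sum>k<M. sin (real k * real i * pi / real M) * sin (real k * real j * pi / real M))
           = (if i = j then real M / 2 else 0)"
proof (cases "j \<le> i")
  case True
  then show ?thesis using assms by (intro sum_sin_sin_grid_le) auto
next
  case False
  then show ?thesis using assms sum_sin_sin_grid_le[of i j M] by (simp add: mult.commute)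
qed

text \<open>
  Matrix orders are written \<open>M - 1\<close> throughout; rewriting them to \<open>M - Suc 0\<close> would keep the carrier
  facts from matching.
\<close>

declare One_nat_def [simp del]

lemma smult_smult_mat: "a \<cdot>\<^sub>m (b \<cdot>\<^sub>m A) = (a * b) \<cdot>\<^sub>m (A :: 'a :: semigroup_mult mat)"
  by (rule eq_matI) (auto simp: mult.assoc)

lemma one_smult_mat: "1 \<cdot>\<^sub>m A = (A :: 'a :: monoid_mult mat)"
  by (rule eq_matI) auto

lemma sine_mat_carrier [simp]: "sine_mat M \<in> carrier_mat (M - 1) (M - 1)"
  by (simp add: sine_mat_def)

lemma dim_sine_mat [simp]: "dim_row (sine_mat M) = M - 1" "dim_col (sine_mat M) = M - 1"
  by (simp_all add: sine_mat_def)

lemma sine_mat_sym: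
  "i < M - 1 \<Longrightarrow> j < M - 1 \<Longrightarrow> sine_mat M $$ (i, j) = sine_mat M $$ (j, i)"
  by (simp add: sine_mat_def mult.commute)

lemma transpose_sine_mat [simp]: "transpose_mat (sine_mat M) = sine_mat M"
  by (rule eq_matI) (auto simp: sine_mat_sym)

text \<open>
  The matrix is symmetric, so the entries of its square are the inner products of its columns.
\<close>

lemma sine_mat_square:
  assumes "0 < M"
  shows "sine_mat M * sine_mat M = (real M / 2) \<cdot>\<^sub>m 1\<^sub>m (M - 1)"
proof (rule eq_matI)
  fix i j
  assume "i < dim_row ((real M / 2) \<cdot>\<^sub>m 1\<^sub>m (M - 1))" "j < dim_col ((real M / 2) \<cdot>\<^sub>m 1\<^sub>m (M - 1))"
  then have i: "i < M - 1" and j: "j < M - 1" by auto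
  define f where "f k = sin (real k * real (Suc i) * pi / real M) *
    sin (real k * real (Suc j) * pi / real M)" for k
  have "(sine_mat M * sine_mat M) $$ (i, j) = (\<Sum>k<M - 1. f (Suc k))"
    using i j by (simp add: sine_mat_def scalar_prod_def f_def atLeast0LessThan mult.commute)
  \<comment> \<open>The boundary node \<open>k = 0\<close> contributes nothing and completes the range to \<open>k < M\<close>.\<close>
  also have "\<dots> = (\<Sum>k<Suc (M - 1). f k)"
    by (subst sum.lessThan_Suc_shift) (simp add: f_def)
  also have "\<dots> = (if i = j then real M / 2 else 0)"
    using sum_sin_sin_grid[of "Suc j" M "Suc i"] i j assms by (simp add: f_def)
  finally show "(sine_mat M * sine_mat M) $$ (i, j) = ((real M / 2) \<cdot>\<^sub>m 1\<^sub>m (M - 1)) $$ (i, j)"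
    using i j by simp
qed auto

text \<open>
  The scaled matrix is a two-sided inverse, so \<open>mat_inverse\<close> does not fail, and whatever it returns
  is the same matrix because inverses are unique.
\<close>

lemma mat_inverse_sine_mat:
  assumes "0 < M"
  shows "mat_inverse (sine_mat M) = Some ((2 / real M) \<cdot>\<^sub>m sine_mat M)"
proof -
  let ?P = "sine_mat M" and ?R = "(2 / real M) \<cdot>\<^sub>m sine_mat M"
  have R: "?R \<in> carrier_mat (M - 1) (M - 1)" by simp
  have inv: "?P * ?R = 1\<^sub>m (M - 1)" "?R * ?P = 1\<^sub>m (M - 1)"
    using assms by (auto simp: mult_smult_distrib[OF sine_mat_carrier sine_mat_carrier]
        mult_smult_assoc_mat[OF sine_mat_carrier sine_mat_carrier] sine_mat_square
        smult_smult_mat one_smult_mat)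
  have "?P \<in> Units (ring_mat TYPE(real) (M - 1) ())"
    unfolding Units_def ring_mat_def using inv R by (auto intro!: bexI[of _ ?R])
  then obtain B where B: "mat_inverse ?P = Some B"
    using mat_inverse(1)[OF sine_mat_carrier, of M "()"] by (cases "mat_inverse ?P") auto
  then have PB: "?P * B = 1\<^sub>m (M - 1)" and Bc: "B \<in> carrier_mat (M - 1) (M - 1)"
    using mat_inverse(2)[OF sine_mat_carrier] by auto
  have "?R = ?R * (?P * B)" using PB R by simp
  also have "\<dots> = B"
    using inv(2) Bc by (simp flip: assoc_mult_mat[OF R sine_mat_carrier Bc])
  finally show ?thesis using B by simp
qed

section \<open>Matrices diagonal in the sine basis\<close>

text \<open>
  This is \<open>P D P\<inverse>\<close> for the sine matrix \<open>P\<close> and \<open>D = diag(d)\<close>, with \<open>P\<inverse> = 2/M P\<close> written out.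
  The function \<open>d\<close> is indexed from 0, so \<open>d i\<close> belongs to mode \<open>i + 1\<close>.
\<close>

definition sine_multiplier :: "nat \<Rightarrow> (nat \<Rightarrow> real) \<Rightarrow> real mat" where
  "sine_multiplier M d =
     (2 / real M) \<cdot>\<^sub>m (sine_mat M * (mat_diag (M - 1) d * sine_mat M))"

lemma sine_multiplier_carrier [simp]: "sine_multiplier M d \<in> carrier_mat (M - 1) (M - 1)"
  by (auto simp: sine_multiplier_def intro!: mult_carrier_mat[of _ _ "M - 1"])

lemma dim_sine_multiplier [simp]:
  "dim_row (sine_multiplier M d) = M - 1" "dim_col (sine_multiplier M d) = M - 1"
  by (simp_all add: sine_multiplier_def)

lemma sine_multiplier_index:
  assumes "i < M - 1" "j < M - 1"
  shows "sine_multiplier M d $$ (i, j) =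
    (\<Sum>k<M - 1. (2 / real M) * sine_mat M $$ (i, k) * d k * sine_mat M $$ (k, j))"
  using assms
  by (simp add: sine_multiplier_def mat_diag_mult_left[OF sine_mat_carrier] scalar_prod_def
      atLeast0LessThan sum_distrib_left mult.assoc)

lemma fractional_mat_eq_sine_multiplier:
  assumes "0 < M"
  shows "fractional_mat \<alpha> M h =
    sine_multiplier M (\<lambda>i. compact_eigenvalue M h (Suc i) powr (\<alpha> / 2))"
proof -
  let ?D = "mat_diag (M - 1) (\<lambda>i. compact_eigenvalue M h (Suc i) powr (\<alpha> / 2))"
  have "fractional_mat \<alpha> M h = (sine_mat M * ?D) * ((2 / real M) \<cdot>\<^sub>m sine_mat M)"
    using assms by (simp add: fractional_mat_def mat_inverse_sine_mat)
  also have "\<dots> = (2 / real M) \<cdot>\<^sub>m ((sine_mat M * ?D) * sine_mat M)"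
    by (rule mult_smult_distrib[OF mult_carrier_mat[OF sine_mat_carrier mat_diag_dim] sine_mat_carrier])
  also have "(sine_mat M * ?D) * sine_mat M = sine_mat M * (?D * sine_mat M)"
    by (rule assoc_mult_mat[OF sine_mat_carrier mat_diag_dim sine_mat_carrier])
  finally show ?thesis by (simp add: sine_multiplier_def)
qed

lemma transpose_sine_multiplier [simp]:
  "transpose_mat (sine_multiplier M d) = sine_multiplier M d"
  by (rule eq_matI) (auto simp: sine_multiplier_index intro!: sum.cong
      simp: sine_mat_sym mult_ac)

lemma sine_multiplier_one:
  assumes "0 < M"
  shows "sine_multiplier M (\<lambda>_. 1) = 1\<^sub>m (M - 1)"
  using assms by (simp add: sine_multiplier_def mat_diag_one sine_mat_square
      left_mult_one_mat[of _ "M - 1" "M - 1"] smult_smult_mat one_smult_mat)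

lemma sine_multiplier_smult: "c \<cdot>\<^sub>m sine_multiplier M d = sine_multiplier M (\<lambda>i. c * d i)"
  by (rule eq_matI) (auto simp: sine_multiplier_index sum_distrib_left intro!: sum.cong)

lemma sine_multiplier_add:
  "sine_multiplier M d + sine_multiplier M e = sine_multiplier M (\<lambda>i. d i + e i)"
  by (rule eq_matI) (auto simp: sine_multiplier_index sum.distrib[symmetric] algebra_simps
      add_divide_distrib intro!: sum.cong)

lemma sine_multiplier_diff:
  "sine_multiplier M d - sine_multiplier M e = sine_multiplier M (\<lambda>i. d i - e i)"
  by (rule eq_matI) (auto simp: sine_multiplier_index sum_subtractf[symmetric] algebra_simps
      diff_divide_distrib intro!: sum.cong)

lemma sine_multiplier_mult:
  assumes "0 < M"
  shows "sine_multiplier M d * sine_multiplier M e = sine_multiplier M (\<lambda>i. d i * e i)"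
proof -
  let ?n = "M - 1" and ?P = "sine_mat M"
  let ?D = "mat_diag ?n d" and ?E = "mat_diag ?n e"
  have D: "?D \<in> carrier_mat ?n ?n" and E: "?E \<in> carrier_mat ?n ?n" by auto
  have DP: "?D * ?P \<in> carrier_mat ?n ?n" and EP: "?E * ?P \<in> carrier_mat ?n ?n"
    using mult_carrier_mat[OF D sine_mat_carrier] mult_carrier_mat[OF E sine_mat_carrier] by auto
  have "(?P * (?D * ?P)) * (?P * (?E * ?P)) = ?P * (?D * ((?P * ?P) * (?E * ?P)))"
    using D E DP EP mult_carrier_mat[OF sine_mat_carrier EP]
    by (simp add: assoc_mult_mat[of _ ?n ?n _ ?n _ ?n])
  also have "\<dots> = (real M / 2) \<cdot>\<^sub>m (?P * (?D * (?E * ?P)))"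
    using EP assms mult_carrier_mat[OF D EP]
    by (simp add: sine_mat_square left_mult_one_mat[OF EP] mult_smult_assoc_mat[of _ ?n ?n _ ?n]
        mult_smult_distrib[of _ ?n ?n _ ?n])
  also have "?D * (?E * ?P) = mat_diag ?n (\<lambda>i. d i * e i) * ?P"
    by (simp flip: assoc_mult_mat[OF D E sine_mat_carrier])
  finally show ?thesis
    using assms mult_carrier_mat[OF sine_mat_carrier DP] mult_carrier_mat[OF sine_mat_carrier EP]
    by (simp add: sine_multiplier_def mult_smult_assoc_mat[of _ ?n ?n _ ?n]
        mult_smult_distrib[of _ ?n ?n _ ?n] smult_smult_mat one_smult_mat)
qed

section \<open>Contraction in the grid norm\<close>

lemma grid_norm_square:
  "(grid_norm V)\<^sup>2 = (\<Sum>j<dim_col V. \<Sum>i<dim_row V. (V $$ (i, j))\<^sup>2)"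
  unfolding grid_norm_def L2_set_def
  by (subst real_sqrt_pow2, simp add: sum_nonneg,
      subst sum.swap, simp add: sum.cartesian_product)

lemma grid_norm_nonneg [simp]: "0 \<le> grid_norm V"
  by (simp add: grid_norm_def)

lemma grid_norm_transpose [simp]: "grid_norm (transpose_mat V) = grid_norm V"
proof -
  have "(grid_norm (transpose_mat V))\<^sup>2 = (grid_norm V)\<^sup>2"
    unfolding grid_norm_square by (subst sum.swap) simp
  then show ?thesis by (simp add: power2_eq_iff_nonneg)
qed

text \<open>
  Writing the squared norm as the trace of the Gram matrix lets the norm of \<open>P V\<close> be computed by
  matrix algebra, from \<open>P\<^sup>T P\<close> alone.
\<close>

lemma grid_norm_square_gram:
  "(grid_norm V)\<^sup>2 = (\<Sum>j<dim_col V. (transpose_mat V * V) $$ (j, j))"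
  unfolding grid_norm_square
  by (simp add: scalar_prod_def power2_eq_square atLeast0LessThan)

lemma grid_norm_sine_mat:
  assumes "0 < M" and V: "V \<in> carrier_mat (M - 1) m"
  shows "(grid_norm (sine_mat M * V))\<^sup>2 = real M / 2 * (grid_norm V)\<^sup>2"
proof -
  let ?n = "M - 1" and ?P = "sine_mat M"
  have PV: "?P * V \<in> carrier_mat ?n m" and Vt: "transpose_mat V \<in> carrier_mat m ?n"
    using V by auto
  have "transpose_mat (?P * V) * (?P * V) = transpose_mat V * ((?P * ?P) * V)"
    using V PV Vt by (simp add: transpose_mult[OF sine_mat_carrier V]
        assoc_mult_mat[of _ m ?n _ ?n _ m] assoc_mult_mat[of _ ?n ?n _ ?n _ m])
  also have "\<dots> = (real M / 2) \<cdot>\<^sub>m (transpose_mat V * V)"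
    using V Vt assms(1) by (simp add: sine_mat_square mult_smult_assoc_mat[of _ ?n ?n _ m]
        mult_smult_distrib[of _ m ?n _ m])
  finally have "transpose_mat (?P * V) * (?P * V) = (real M / 2) \<cdot>\<^sub>m (transpose_mat V * V)" .
  then show ?thesis
    using V by (simp add: grid_norm_square_gram sum_distrib_left)
qed

lemma grid_norm_smult: "(grid_norm (c \<cdot>\<^sub>m V))\<^sup>2 = c\<^sup>2 * (grid_norm V)\<^sup>2"
  by (simp add: grid_norm_square sum_distrib_left power_mult_distrib)

lemma grid_norm_mat_diag_le:
  assumes V: "V \<in> carrier_mat n m" and d: "\<And>i. i < n \<Longrightarrow> \<bar>d i\<bar> \<le> 1"
  shows "(grid_norm (mat_diag n d * V))\<^sup>2 \<le> (grid_norm V)\<^sup>2"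
proof -
  have "(d i * x)\<^sup>2 \<le> x\<^sup>2" if "i < n" for i x
  proof -
    have "(d i)\<^sup>2 \<le> 1" using d[OF that] by (simp add: abs_square_le_1)
    then show ?thesis by (simp add: power_mult_distrib mult_left_le_one_le)
  qed
  then show ?thesis
    using V unfolding grid_norm_square
    by (auto simp: mat_diag_mult_left[OF V] intro!: sum_mono)
qed

text \<open>
  Passing to sine coefficients and back scales the squared norm by \<open>M / 2\<close> twice, which the
  prefactor \<open>2 / M\<close> compensates; in between, the diagonal matrix shrinks every coefficient.
\<close>

lemma grid_norm_sine_multiplier_left_le:
  assumes M: "0 < M" and V: "V \<in> carrier_mat (M - 1) m"
    and d: "\<And>i. i < M - 1 \<Longrightarrow> \<bar>d i\<bar> \<le> 1"
  shows "grid_norm (sine_multiplier M d * V) \<le> grid_norm V"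
proof -
  let ?n = "M - 1" and ?P = "sine_mat M" and ?D = "mat_diag (M - 1) d"
  have PV: "?P * V \<in> carrier_mat ?n m" using V by auto
  have DPV: "?D * (?P * V) \<in> carrier_mat ?n m" by (rule mult_carrier_mat[OF mat_diag_dim PV])
  have DP: "?D * ?P \<in> carrier_mat ?n ?n"
    by (rule mult_carrier_mat[OF mat_diag_dim sine_mat_carrier])
  have eq: "sine_multiplier M d * V = (2 / real M) \<cdot>\<^sub>m (?P * (?D * (?P * V)))"
    using V DP mult_carrier_mat[OF sine_mat_carrier DP]
    by (simp add: sine_multiplier_def mult_smult_assoc_mat[of _ ?n ?n _ m]
        assoc_mult_mat[of _ ?n ?n _ ?n _ m])
  have "(grid_norm (sine_multiplier M d * V))\<^sup>2
      = (2 / real M)\<^sup>2 * (real M / 2 * (grid_norm (?D * (?P * V)))\<^sup>2)"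
    unfolding eq grid_norm_smult grid_norm_sine_mat[OF M DPV] ..
  also have "\<dots> \<le> (2 / real M)\<^sup>2 * (real M / 2 * (grid_norm (?P * V))\<^sup>2)"
    by (intro mult_left_mono grid_norm_mat_diag_le[OF PV] d) auto
  also have "\<dots> = (grid_norm V)\<^sup>2"
    using M unfolding grid_norm_sine_mat[OF M V] by (simp add: power2_eq_square)
  finally show ?thesis by (simp add: power_mono_iff)
qed

lemma grid_norm_sine_multiplier_right_le:
  assumes M: "0 < M" and V: "V \<in> carrier_mat m (M - 1)"
    and d: "\<And>i. i < M - 1 \<Longrightarrow> \<bar>d i\<bar> \<le> 1"
  shows "grid_norm (V * sine_multiplier M d) \<le> grid_norm V"
proof -
  have "transpose_mat (V * sine_multiplier M d) = sine_multiplier M d * transpose_mat V"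
    using transpose_mult[OF V sine_multiplier_carrier] by simp
  then have "grid_norm (V * sine_multiplier M d) = grid_norm (sine_multiplier M d * transpose_mat V)"
    by (metis grid_norm_transpose)
  also have "\<dots> \<le> grid_norm (transpose_mat V)"
    using V by (intro grid_norm_sine_multiplier_left_le[OF M _ d]) auto
  finally show ?thesis by simp
qed

section \<open>The scheme in the sine basis\<close>

lemma two_sided_equation_iff:
  fixes A A' B B' V W :: "'a :: semiring_1 mat"
  assumes A: "A \<in> carrier_mat n n" "A' \<in> carrier_mat n n" "A * A' = 1\<^sub>m n" "A' * A = 1\<^sub>m n"
    and B: "B \<in> carrier_mat m m" "B' \<in> carrier_mat m m" "B * B' = 1\<^sub>m m" "B' * B = 1\<^sub>m m"
    and V: "V \<in> carrier_mat n m" and W: "W \<in> carrier_mat n m"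
  shows "A * (V * B) = W \<longleftrightarrow> V = A' * (W * B')"
proof
  assume "A * (V * B) = W"
  then have "A' * (W * B') = A' * ((A * (V * B)) * B')" by simp
  also have "\<dots> = (A' * A) * (V * (B * B'))"
    using A(1,2) B(1,2) V
    by (simp add: assoc_mult_mat[of _ n n _ m _ m] assoc_mult_mat[of _ n m _ m _ m]
        assoc_mult_mat[of _ n n _ n _ m])
  finally show "V = A' * (W * B')" using A B V by simp
next
  assume "V = A' * (W * B')"
  then have "A * (V * B) = A * ((A' * (W * B')) * B)" by simp
  also have "\<dots> = (A * A') * (W * (B' * B))"
    using A(1,2) B(1,2) W
    by (simp add: assoc_mult_mat[of _ n n _ m _ m] assoc_mult_mat[of _ n m _ m _ m]
        assoc_mult_mat[of _ n n _ n _ m])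
  finally show "A * (V * B) = W" using A B W by simp
qed

text \<open>
  The amplification factor of the Crank-Nicolson step for a single mode.
\<close>

lemma abs_cayley_le_1: "0 \<le> x \<Longrightarrow> \<bar>inverse (1 + x) * (1 - x)\<bar> \<le> (1::real)"
  by (simp add: abs_mult abs_inverse field_simps)

text \<open>
  The scheme with its spatial operators replaced by arbitrary matrices diagonal in the sine basis:
  \<open>p\<close> and \<open>q\<close> are the eigenvalues of \<open>S\<^sub>x\<close> and \<open>T\<^sub>y\<close>, and \<open>R\<close> collects the source.
\<close>

definition splitting_step ::
  "nat \<Rightarrow> nat \<Rightarrow> (nat \<Rightarrow> real) \<Rightarrow> (nat \<Rightarrow> real) \<Rightarrow> real mat \<Rightarrow> real mat \<Rightarrow> real mat \<Rightarrow> bool" where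
  "splitting_step M1 M2 p q R U V \<longleftrightarrow>
     sine_multiplier M1 (\<lambda>i. 1 + p i) * (V * sine_multiplier M2 (\<lambda>j. 1 + q j)) =
     sine_multiplier M1 (\<lambda>i. 1 - p i) * (U * sine_multiplier M2 (\<lambda>j. 1 - q j)) + R"

lemma one_plus_inverse_sine_multiplier:
  assumes M: "0 < M" and p: "\<And>i. 0 \<le> p i"
  shows "sine_multiplier M (\<lambda>i. 1 + p i) * sine_multiplier M (\<lambda>i. inverse (1 + p i)) = 1\<^sub>m (M - 1)"
    and "sine_multiplier M (\<lambda>i. inverse (1 + p i)) * sine_multiplier M (\<lambda>i. 1 + p i) = 1\<^sub>m (M - 1)"
proof -
  have "1 + p i \<noteq> 0" for i using p[of i] by linarith
  then show "sine_multiplier M (\<lambda>i. 1 + p i) * sine_multiplier M (\<lambda>i. inverse (1 + p i)) = 1\<^sub>m (M - 1)"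
    and "sine_multiplier M (\<lambda>i. inverse (1 + p i)) * sine_multiplier M (\<lambda>i. 1 + p i) = 1\<^sub>m (M - 1)"
    using M by (simp_all add: sine_multiplier_mult sine_multiplier_one)
qed

lemma splitting_step_iff:
  assumes M: "0 < M1" "0 < M2" and pq: "\<And>i. 0 \<le> p i" "\<And>j. 0 \<le> q j"
    and V: "V \<in> carrier_mat (M1 - 1) (M2 - 1)"
    and R: "R \<in> carrier_mat (M1 - 1) (M2 - 1)"
  shows "splitting_step M1 M2 p q R U V \<longleftrightarrow>
    V = sine_multiplier M1 (\<lambda>i. inverse (1 + p i)) *
      ((sine_multiplier M1 (\<lambda>i. 1 - p i) * (U * sine_multiplier M2 (\<lambda>j. 1 - q j)) + R) *
        sine_multiplier M2 (\<lambda>j. inverse (1 + q j)))"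
  unfolding splitting_step_def
  using R
  by (intro two_sided_equation_iff[OF sine_multiplier_carrier sine_multiplier_carrier
        one_plus_inverse_sine_multiplier[OF M(1) pq(1)]
        sine_multiplier_carrier sine_multiplier_carrier
        one_plus_inverse_sine_multiplier[OF M(2) pq(2)] V]) auto

lemma splitting_step_ex1:
  assumes M: "0 < M1" "0 < M2" and pq: "\<And>i. 0 \<le> p i" "\<And>j. 0 \<le> q j"
    and R: "R \<in> carrier_mat (M1 - 1) (M2 - 1)"
  shows "\<exists>!V. V \<in> carrier_mat (M1 - 1) (M2 - 1) \<and> splitting_step M1 M2 p q R U V"
proof -
  let ?V = "sine_multiplier M1 (\<lambda>i. inverse (1 + p i)) *
      ((sine_multiplier M1 (\<lambda>i. 1 - p i) * (U * sine_multiplier M2 (\<lambda>j. 1 - q j)) + R) *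
        sine_multiplier M2 (\<lambda>j. inverse (1 + q j)))"
  have c: "?V \<in> carrier_mat (M1 - 1) (M2 - 1)"
    using R by (intro mult_carrier_mat[of _ _ "M1 - 1"] mult_carrier_mat[of _ _ "M2 - 1"]) auto
  show ?thesis
    using c splitting_step_iff[OF M pq _ R] by (intro ex1I[of _ ?V]) auto
qed

text \<open>
  By linearity the common source cancels from the difference of two solutions.
\<close>

lemma splitting_step_diff:
  assumes U: "U \<in> carrier_mat (M1 - 1) (M2 - 1)" and V: "V \<in> carrier_mat (M1 - 1) (M2 - 1)"
    and U': "U' \<in> carrier_mat (M1 - 1) (M2 - 1)" and V': "V' \<in> carrier_mat (M1 - 1) (M2 - 1)"
    and R: "R \<in> carrier_mat (M1 - 1) (M2 - 1)"
    and step: "splitting_step M1 M2 p q R U V" "splitting_step M1 M2 p q R U' V'"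
  shows "splitting_step M1 M2 p q (0\<^sub>m (M1 - 1) (M2 - 1)) (U - U') (V - V')"
proof -
  let ?n = "M1 - 1" and ?m = "M2 - 1"
  have lin: "A * ((X - Y) * B) = A * (X * B) - A * (Y * B)"
    if "A \<in> carrier_mat ?n ?n" "B \<in> carrier_mat ?m ?m"
      "X \<in> carrier_mat ?n ?m" "Y \<in> carrier_mat ?n ?m" for A B X Y :: "real mat"
  proof -
    have "A * ((X - Y) * B) = A * (X * B - Y * B)"
      using that by (simp add: minus_mult_distrib_mat[of _ ?n ?m])
    also have "\<dots> = A * (X * B) - A * (Y * B)"
      using that by (intro mult_minus_distrib_mat[of _ ?n ?n _ ?m]) auto
    finally show ?thesis .
  qed
  have cancel: "(X + R) - (Y + R) = (X - Y) + 0\<^sub>m ?n ?m"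
    if "X \<in> carrier_mat ?n ?m" "Y \<in> carrier_mat ?n ?m" for X Y
    using that R by (intro eq_matI) auto
  have c: "sine_multiplier M1 d * (X * sine_multiplier M2 e) \<in> carrier_mat ?n ?m"
    if "X \<in> carrier_mat ?n ?m" for X d e
    using that by (intro mult_carrier_mat[of _ _ ?n] mult_carrier_mat[of _ _ ?m]) auto
  show ?thesis
    using step U V U' V' unfolding splitting_step_def
    by (simp add: lin cancel c)
qed

text \<open>
  Solving for \<open>V\<close> gives \<open>V = G U H\<close> with \<open>G = (I + S\<^sub>x)\<inverse> (I - S\<^sub>x)\<close> and likewise \<open>H\<close> for the
  other direction. Both are sine multipliers by Cayley factors of modulus at most 1, so each of
  the two multiplications is a contraction.
\<close>

lemma splitting_step_homogeneous_contraction: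
  assumes M: "0 < M1" "0 < M2" and pq: "\<And>i. 0 \<le> p i" "\<And>j. 0 \<le> q j"
    and U: "U \<in> carrier_mat (M1 - 1) (M2 - 1)" and V: "V \<in> carrier_mat (M1 - 1) (M2 - 1)"
    and step: "splitting_step M1 M2 p q (0\<^sub>m (M1 - 1) (M2 - 1)) U V"
  shows "grid_norm V \<le> grid_norm U"
proof -
  let ?n = "M1 - 1" and ?m = "M2 - 1"
  let ?A = "sine_multiplier M1 (\<lambda>i. inverse (1 + p i))" and ?C = "sine_multiplier M1 (\<lambda>i. 1 - p i)"
  let ?B = "sine_multiplier M2 (\<lambda>j. inverse (1 + q j))" and ?D = "sine_multiplier M2 (\<lambda>j. 1 - q j)"
  let ?G = "sine_multiplier M1 (\<lambda>i. inverse (1 + p i) * (1 - p i))"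
  let ?H = "sine_multiplier M2 (\<lambda>j. inverse (1 + q j) * (1 - q j))"
  have CUD: "?C * (U * ?D) \<in> carrier_mat ?n ?m"
    using U by (intro mult_carrier_mat[of _ _ ?n] mult_carrier_mat[of _ _ ?m]) auto
  have "V = ?A * ((?C * (U * ?D)) * ?B)"
    using step splitting_step_iff[OF M pq V, of "0\<^sub>m ?n ?m"] CUD by simp
  also have "\<dots> = (?A * ?C) * (U * (?D * ?B))"
    using U mult_carrier_mat[OF U mult_carrier_mat[OF sine_multiplier_carrier
        sine_multiplier_carrier]]
    by (simp add: assoc_mult_mat[of _ ?n ?n _ ?m _ ?m] assoc_mult_mat[of _ ?n ?m _ ?m _ ?m]
        assoc_mult_mat[of _ ?n ?n _ ?n _ ?m])
  also have "\<dots> = ?G * (U * ?H)"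
    using M by (simp add: sine_multiplier_mult mult.commute)
  finally have "V = ?G * (U * ?H)" .
  also have "grid_norm \<dots> \<le> grid_norm (U * ?H)"
    using U M pq abs_cayley_le_1
    by (intro grid_norm_sine_multiplier_left_le[of _ _ ?m] mult_carrier_mat[of _ _ ?m]) auto
  also have "\<dots> \<le> grid_norm U"
    using U M pq abs_cayley_le_1 by (intro grid_norm_sine_multiplier_right_le) auto
  finally show ?thesis .
qed

text \<open>
  The eigenvalue of \<open>S\<^sub>x\<close> (for \<open>c = k\<^sub>t/2 C\<^sub>x\<close>) or of \<open>T\<^sub>y\<close> on mode \<open>i + 1\<close>.
\<close>

definition step_symbol :: "real \<Rightarrow> real \<Rightarrow> nat \<Rightarrow> real \<Rightarrow> nat \<Rightarrow> real" where
  "step_symbol c \<alpha> M h i = c * compact_eigenvalue M h (Suc i) powr (\<alpha> / 2)"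

text \<open>
  The identity is the multiplier of the constant 1, so \<open>I + S\<^sub>x\<close> and its companions are sine
  multipliers as well, and symmetry removes the transposes.
\<close>

lemma scheme_step_eq_splitting_step:
  assumes "0 < M1" "0 < M2"
  shows "scheme_step \<alpha> \<beta> Cx Cy T L1 R1 L2 R2 M1 M2 N s n U V \<longleftrightarrow>
    splitting_step M1 M2
      (step_symbol (T / real N / 2 * Cx) \<alpha> M1 ((R1 - L1) / real M1))
      (step_symbol (T / real N / 2 * Cy) \<beta> M2 ((R2 - L2) / real M2))
      ((T / real N / 2) \<cdot>\<^sub>m (source_grid L1 R1 L2 R2 T M1 M2 N s n
        + source_grid L1 R1 L2 R2 T M1 M2 N s (Suc n))) U V"
  using assms
  unfolding scheme_step_def splitting_step_def Let_def act_x_def act_y_def step_symbol_def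
  by (simp only: fractional_mat_eq_sine_multiplier sine_multiplier_one[symmetric]
      sine_multiplier_smult sine_multiplier_add sine_multiplier_diff transpose_sine_multiplier)

theorem theorem4p1:
  fixes \<alpha> \<beta> Cx Cy T L1 R1 L2 R2 :: real
  assumes "1 < \<alpha>" "\<alpha> \<le> 2" "1 < \<beta>" "\<beta> \<le> 2"
    and "0 \<le> Cx" "0 \<le> Cy" "0 < T"
    and "L1 < R1" "L2 < R2"
  shows "unconditionally_stable (scheme_step \<alpha> \<beta> Cx Cy T L1 R1 L2 R2)"
  unfolding unconditionally_stable_def
proof (intro exI[of _ 1] allI impI conjI)
  fix M1 M2 N :: nat
  assume "2 \<le> M1 \<and> 2 \<le> M2 \<and> 1 \<le> N"
  then have M: "0 < M1" "0 < M2" by auto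
  let ?step = "scheme_step \<alpha> \<beta> Cx Cy T L1 R1 L2 R2"
  define p where "p = step_symbol (T / real N / 2 * Cx) \<alpha> M1 ((R1 - L1) / real M1)"
  define q where "q = step_symbol (T / real N / 2 * Cy) \<beta> M2 ((R2 - L2) / real M2)"
  define R where "R s n = (T / real N / 2) \<cdot>\<^sub>m (source_grid L1 R1 L2 R2 T M1 M2 N s n
    + source_grid L1 R1 L2 R2 T M1 M2 N s (Suc n))" for s n
  have pq: "0 \<le> p i" "0 \<le> q i" for i
    using assms by (auto simp: p_def q_def step_symbol_def)
  have R: "R s n \<in> carrier_mat (M1 - 1) (M2 - 1)" for s n
    by (simp add: R_def source_grid_def)
  have step: "?step M1 M2 N s n U V \<longleftrightarrow> splitting_step M1 M2 p q (R s n) U V" for s n U V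
    using scheme_step_eq_splitting_step[OF M] by (simp add: p_def q_def R_def)
  show "\<exists>!V. V \<in> carrier_mat (M1 - 1) (M2 - 1) \<and> ?step M1 M2 N s n U V"
    if "n < N \<and> U \<in> carrier_mat (M1 - 1) (M2 - 1)" for s n U
    unfolding step by (intro splitting_step_ex1[OF M pq R])
  show "grid_norm (u n - v n) \<le> 1 * grid_norm (u0 - v0)"
    if sol: "grid_solution ?step M1 M2 N s u0 u \<and> grid_solution ?step M1 M2 N s v0 v"
      and "n \<le> N" for s u0 v0 u v n
    using \<open>n \<le> N\<close>
  proof (induction n)
    case 0
    then show ?case using sol by (simp add: grid_solution_def)
  next
    case (Suc n)
    have c: "u k \<in> carrier_mat (M1 - 1) (M2 - 1)" "v k \<in> carrier_mat (M1 - 1) (M2 - 1)"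
      if "k \<le> N" for k
      using sol that by (auto simp: grid_solution_def)
    have "splitting_step M1 M2 p q (R s n) (u n) (u (Suc n))"
      "splitting_step M1 M2 p q (R s n) (v n) (v (Suc n))"
      using sol Suc.prems by (auto simp: grid_solution_def step)
    then have "splitting_step M1 M2 p q (0\<^sub>m (M1 - 1) (M2 - 1)) (u n - v n) (u (Suc n) - v (Suc n))"
      using c Suc.prems by (intro splitting_step_diff[OF _ _ _ _ R]) auto
    then have "grid_norm (u (Suc n) - v (Suc n)) \<le> grid_norm (u n - v n)"
      using c Suc.prems
      by (intro splitting_step_homogeneous_contraction[OF M pq] minus_carrier_mat) auto
    also have "\<dots> \<le> 1 * grid_norm (u0 - v0)"
      using Suc by simp
    finally show ?case .
  qed
qed

end
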